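(* Let $L\ge 2$, let $w(l)=\frac{1}{L-1}$ for all $l\in[L-1]$, and let the loss be the mean squared error $\mathcal{L}(u,v)=\frac1H\sum_{h=1}^{H}(u_h-v_h)^2$ for $u,v\in\mathbb{R}^H$. Fix a hyperparameter $\lambda\in\Lambda$. For each level $l\in[L-1]$, node $j\in[N_l]$ and time $t\in\{T+1,\dots,T+H\}$, let $x_t^{l,j}$ be the true value, $\tilde{x}_t^{l,j}$ the teacher's proxy forecast, and $\hat{x}_t^{l,j}$ the bottom-up aggregated student forecast obtained with hyperparameter $\lambda$. Put $\epsilon_t^{l,j}=|x_t^{l,j}-\tilde{x}_t^{l,j}|$ and $\delta_t^{l,j}=|x_t^{l,j}-\hat{x}_t^{l,j}|$. Let $$\mathcal{E}=\frac{1}{L-1}\sum_{l=1}^{L-1}\frac{1}{N_l}\sum_{j=1}^{N_l}\frac1H\sum_{t=T+1}^{T+H}\left(\tilde{x}_t^{l,j}-x_t^{l,j}\right)^2$$ be the teacher's aggregated mean squared error over all higher levels, and let $\mathcal{O}=\mathcal{O}(\lambda)$ and $\mathcal{O}^\ast=\mathcal{O}^\ast(\lambda)$ be the values at $\lambda$ of the H-Pro objective and of the OPT-BU objective respectively. Then $$\left|\mathcal{O}-\mathcal{O}^\ast\right|\le \mathcal{E}+\frac{2}{L-1}\sum_{l=1}^{L-1}\frac{1}{N_l}\sum_{j=1}^{N_l}\frac1H\sum_{t=T+1}^{T+H}\epsilon_t^{l,j}\,\delta_t^{l,j}.$$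
   Context: Notation: $[n]=\{1,\dots,n\}$. A hierarchical time series dataset is attached to a rooted tree with levels $1,\dots,L$ ($l=1$ the top level, $l=L$ the lowest level, that of the leaf nodes) with $N_l$ nodes at level $l$. Node $j$ at level $l$ carries a real-valued time series $x_t^{l,j}$, $t=1,\dots,T+H$, where $1,\dots,T$ is the historical period and $T+1,\dots,T+H$ is the test period ($H\ge1$ is the forecast horizon). The series are coherent: for $l\in[L-1]$, $x_t^{l,j}=\sum_{i\in C_{l,j}}x_t^{l+1,i}$, where $C_{l,j}$ is the set of children of node $j$ of level $l$. Student: for each hyperparameter $\lambda$ in a set $\Lambda$ there is a forecasting map $f_\lambda:\mathbb{R}^T\to\mathbb{R}^H$ that is applied to the lowest-level histories $x^{L,i}_{1:T}$, $i\in[N_L]$. The bottom-up aggregated student forecast at node $j$ of level $l$ is $$\hat{x}^{l,j}_{T+1:T+H}=\mathcal{B}\left(f_\lambda,\{x^{L,i}_{1:T}\}_{i=1}^{N_L},l,j\right)=\sum_{i} f_\lambda\left(x^{L,i}_{1:T}\right),$$ where the sum runs over the leaf nodes $i$ descending from node $j$ of level $l$. Teacher: for each $l\in[L-1]$ and $j\in[N_l]$ a proxy forecast $\tilde{x}^{l,j}_{T+1:T+H}\in\mathbb{R}^H$ for the test period is given (arbitrary real vectors, not depending on $\lambda$). Objectives, for a loss $\mathcal{L}:\mathbb{R}^H\times\mathbb{R}^H\to\mathbb{R}$ and weights $w(l)\in[0,1]$ with $\sum_{l=1}^{L-1}w(l)=1$: the H-Pro objective is $$\mathcal{O}(\lambda)=\sum_{l=1}^{L-1}w(l)\,\frac{1}{N_l}\sum_{j=1}^{N_l}\mathcal{L}\left(\tilde{x}^{l,j}_{T+1:T+H},\hat{x}^{l,j}_{T+1:T+H}\right),$$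 and the OPT-BU objective is $$\mathcal{O}^\ast(\lambda)=\frac{1}{L-1}\sum_{l=1}^{L-1}\frac{1}{N_l}\sum_{j=1}^{N_l}\mathcal{L}\left(x^{l,j}_{T+1:T+H},\hat{x}^{l,j}_{T+1:T+H}\right).$$ *)

theory Defs
  imports "HOL-Analysis.Analysis"
begin

text \<open>The lengths of the historical and of the test period are natural numbers that enter the
  indexing of the time axis. Therefore \<open>\<real>\<^sup>n\<close> is represented by the extensional
  functions on \<open>{1..n}\<close>, and the segment of a series at the times
  \<open>a + 1, \<dots>, a + n\<close> is re-indexed by \<open>1, \<dots>, n\<close>.\<close>

definition rvec :: "nat \<Rightarrow> (nat \<Rightarrow> real) set" where
  "rvec n = {1..n} \<rightarrow>\<^sub>E UNIV"

definition segment :: "(nat \<Rightarrow> real) \<Rightarrow> nat \<Rightarrow> nat \<Rightarrow> nat \<Rightarrow> real" where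
  "segment s a n = (\<lambda>k\<in>{1..n}. s (a + k))"

text \<open>Conversely, a vector of \<open>\<real>\<^sup>H\<close> that holds the values at the times
  \<open>T + 1, \<dots>, T + H\<close> has the value below at such a time \<open>t\<close>.\<close>

definition at_time :: "nat \<Rightarrow> (nat \<Rightarrow> real) \<Rightarrow> nat \<Rightarrow> real" where
  "at_time T v t = v (t - T)"

text \<open>A node is a pair of its level and its number within the level; \<open>C l j\<close> is the set of
  the numbers, within level \<open>l + 1\<close>, of the children of node \<open>j\<close> of level \<open>l\<close>.
  The leaf nodes are exactly the nodes of level \<open>L\<close>, so the other nodes have children.\<close>

locale level_tree =
  fixes L :: nat and N :: "nat \<Rightarrow> nat" and C :: "nat \<Rightarrow> nat \<Rightarrow> nat set"
  assumes levels: "L \<ge> 1"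
    and single_root: "N 1 = 1"
    and children: "\<And>l j. \<lbrakk>l \<in> {1..L - 1}; j \<in> {1..N l}\<rbrakk> \<Longrightarrow> C l j \<subseteq> {1..N (l + 1)}"
    and unique_parent:
      "\<And>l i. \<lbrakk>l \<in> {1..L - 1}; i \<in> {1..N (l + 1)}\<rbrakk> \<Longrightarrow> \<exists>!j. j \<in> {1..N l} \<and> i \<in> C l j"
    and not_leaf: "\<And>l j. \<lbrakk>l \<in> {1..L - 1}; j \<in> {1..N l}\<rbrakk> \<Longrightarrow> C l j \<noteq> {}"

locale hierarchical_dataset = level_tree L N C
  for L :: nat and N :: "nat \<Rightarrow> nat" and C :: "nat \<Rightarrow> nat \<Rightarrow> nat set" +
  fixes T H :: nat and x :: "nat \<Rightarrow> nat \<Rightarrow> nat \<Rightarrow> real"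
  assumes horizon: "H \<ge> 1"
    and coherent: "\<And>l j t. \<lbrakk>l \<in> {1..L - 1}; j \<in> {1..N l}; t \<in> {1..T + H}\<rbrakk>
      \<Longrightarrow> x l j t = (\<Sum>i\<in>C l j. x (l + 1) i t)"

definition tree_edges ::
    "nat \<Rightarrow> (nat \<Rightarrow> nat) \<Rightarrow> (nat \<Rightarrow> nat \<Rightarrow> nat set) \<Rightarrow> ((nat \<times> nat) \<times> (nat \<times> nat)) set" where
  "tree_edges L N C =
    {((l, j), (l + 1, i)) | l j i. l \<in> {1..L - 1} \<and> j \<in> {1..N l} \<and> i \<in> C l j}"

definition leaf_descendants ::
    "nat \<Rightarrow> (nat \<Rightarrow> nat) \<Rightarrow> (nat \<Rightarrow> nat \<Rightarrow> nat set) \<Rightarrow> nat \<Rightarrow> nat \<Rightarrow> nat set" where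
  "leaf_descendants L N C l j = {i \<in> {1..N L}. ((l, j), (L, i)) \<in> (tree_edges L N C)\<^sup>*}"

text \<open>Here \<open>g\<close> is the forecasting map and \<open>hist i\<close> the history of leaf \<open>i\<close>.\<close>

definition bottom_up ::
    "nat \<Rightarrow> (nat \<Rightarrow> nat) \<Rightarrow> (nat \<Rightarrow> nat \<Rightarrow> nat set) \<Rightarrow> nat \<Rightarrow> ((nat \<Rightarrow> real) \<Rightarrow> nat \<Rightarrow> real)
      \<Rightarrow> (nat \<Rightarrow> nat \<Rightarrow> real) \<Rightarrow> nat \<Rightarrow> nat \<Rightarrow> nat \<Rightarrow> real" where
  "bottom_up L N C H g hist l j =
    (\<lambda>h\<in>{1..H}. \<Sum>i\<in>leaf_descendants L N C l j. g (hist i) h)"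

definition student_forecast ::
    "nat \<Rightarrow> (nat \<Rightarrow> nat) \<Rightarrow> (nat \<Rightarrow> nat \<Rightarrow> nat set) \<Rightarrow> nat \<Rightarrow> nat \<Rightarrow> (nat \<Rightarrow> nat \<Rightarrow> nat \<Rightarrow> real)
      \<Rightarrow> ((nat \<Rightarrow> real) \<Rightarrow> nat \<Rightarrow> real) \<Rightarrow> nat \<Rightarrow> nat \<Rightarrow> nat \<Rightarrow> real" where
  "student_forecast L N C T H x g = bottom_up L N C H g (\<lambda>i. segment (x L i) 0 T)"

definition mse :: "nat \<Rightarrow> (nat \<Rightarrow> real) \<Rightarrow> (nat \<Rightarrow> real) \<Rightarrow> real" where
  "mse H u v = 1 / real H * (\<Sum>h = 1..H. (u h - v h)\<^sup>2)"

text \<open>The objectives take the aggregated student forecasts \<open>xhat\<close> as an argument; the value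
  at a hyperparameter is obtained with the student forecasts for this hyperparameter.\<close>

definition hpro_objective ::
    "nat \<Rightarrow> (nat \<Rightarrow> nat) \<Rightarrow> ((nat \<Rightarrow> real) \<Rightarrow> (nat \<Rightarrow> real) \<Rightarrow> real) \<Rightarrow> (nat \<Rightarrow> real)
      \<Rightarrow> (nat \<Rightarrow> nat \<Rightarrow> nat \<Rightarrow> real) \<Rightarrow> (nat \<Rightarrow> nat \<Rightarrow> nat \<Rightarrow> real) \<Rightarrow> real" where
  "hpro_objective L N loss w xtilde xhat =
    (\<Sum>l = 1..L - 1. w l * (1 / real (N l)) * (\<Sum>j = 1..N l. loss (xtilde l j) (xhat l j)))"

definition opt_bu_objective ::
    "nat \<Rightarrow> (nat \<Rightarrow> nat) \<Rightarrow> ((nat \<Rightarrow> real) \<Rightarrow> (nat \<Rightarrow> real) \<Rightarrow> real) \<Rightarrow> nat \<Rightarrow> nat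
      \<Rightarrow> (nat \<Rightarrow> nat \<Rightarrow> nat \<Rightarrow> real) \<Rightarrow> (nat \<Rightarrow> nat \<Rightarrow> nat \<Rightarrow> real) \<Rightarrow> real" where
  "opt_bu_objective L N loss T H x xhat =
    1 / (real L - 1) *
      (\<Sum>l = 1..L - 1. 1 / real (N l) * (\<Sum>j = 1..N l. loss (segment (x l j) T H) (xhat l j)))"

end

theory Submission
  imports Defs
begin

text \<open>Pointwise, \<open>(a - c)\<^sup>2 - (b - c)\<^sup>2 = (a - b)\<^sup>2 + 2 (a - b) (b - c)\<close>;
  all quantities of the theorem are the same weighted average of terms of this identity, and
  this average is linear and monotone.\<close>

definition level_average ::
    "nat \<Rightarrow> (nat \<Rightarrow> nat) \<Rightarrow> nat \<Rightarrow> nat \<Rightarrow> (nat \<Rightarrow> nat \<Rightarrow> nat \<Rightarrow> real) \<Rightarrow> real" where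
  "level_average L N T H g = 1 / (real L - 1) * (\<Sum>l = 1..L - 1. 1 / real (N l) *
    (\<Sum>j = 1..N l. 1 / real H * (\<Sum>t = T + 1..T + H. g l j t)))"

lemma level_average_add:
  "level_average L N T H (\<lambda>l j t. g l j t + h l j t) =
    level_average L N T H g + level_average L N T H h"
  by (simp only: level_average_def sum.distrib distrib_left)

lemma level_average_diff:
  "level_average L N T H (\<lambda>l j t. g l j t - h l j t) =
    level_average L N T H g - level_average L N T H h"
  by (simp only: level_average_def sum_subtractf right_diff_distrib)

lemma level_average_cmult:
  "level_average L N T H (\<lambda>l j t. c * g l j t) = c * level_average L N T H g"
  by (simp add: level_average_def sum_distrib_left mult.left_commute)

text \<open>All weights are nonnegative: \<open>1 / (real L - 1)\<close> because of
  \<open>L \<ge> 1\<close>, and the others also at a zero denominator, where division yields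
  0.\<close>

lemma level_average_mono:
  assumes "L \<ge> 1"
    and "\<And>l j t. l \<in> {1..L - 1} \<Longrightarrow> j \<in> {1..N l} \<Longrightarrow> t \<in> {T + 1..T + H} \<Longrightarrow> g l j t \<le> h l j t"
  shows "level_average L N T H g \<le> level_average L N T H h"
  unfolding level_average_def using assms by (intro mult_left_mono sum_mono) auto

text \<open>Both \<open>g\<close> and its negative lie below the absolute value of \<open>g\<close>,
  so monotonicity bounds the average from both sides.\<close>

lemma abs_level_average_le:
  assumes "L \<ge> 1"
  shows "\<bar>level_average L N T H g\<bar> \<le> level_average L N T H (\<lambda>l j t. \<bar>g l j t\<bar>)"
proof -
  have "level_average L N T H g \<le> level_average L N T H (\<lambda>l j t. \<bar>g l j t\<bar>)"
    using assms by (intro level_average_mono) auto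
  \<comment> \<open>The negation is written as a factor so that \<open>level_average_cmult\<close>
    can pull it out.\<close>
  moreover have "level_average L N T H (\<lambda>l j t. (-1) * g l j t) \<le>
      level_average L N T H (\<lambda>l j t. \<bar>g l j t\<bar>)"
    using assms by (intro level_average_mono) auto
  ultimately show ?thesis
    unfolding level_average_cmult by linarith
qed

text \<open>The substitution t = T + h passes from positions in the vector to times. Since
  \<open>T\<close> occurs on the right only, each use has to supply it.\<close>

lemma mse_at_time:
  "mse H u v = 1 / real H * (\<Sum>t = T + 1..T + H. (at_time T u t - at_time T v t)\<^sup>2)"
  using sum.shift_bounds_cl_nat_ivl[of "\<lambda>t. (at_time T u t - at_time T v t)\<^sup>2" 1 T H]
  by (simp add: mse_def at_time_def add.commute)

lemma at_time_segment:
  assumes "t \<in> {T + 1..T + H}"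
  shows "at_time T (segment s T H) t = s t"
  using assms by (auto simp: at_time_def segment_def)

lemma hpro_objective_mse:
  assumes "\<And>l. l \<in> {1..L - 1} \<Longrightarrow> w l = 1 / (real L - 1)"
  shows "hpro_objective L N (mse H) w xtilde xhat =
    level_average L N T H (\<lambda>l j t. (at_time T (xtilde l j) t - at_time T (xhat l j) t)\<^sup>2)"
  \<comment> \<open>The value of \<open>w l\<close> is known only for levels in range, so the common
    factor is moved into the sum over the levels and compared with \<open>w l\<close> there. Fixing
    the factor keeps the inner sums intact.\<close>
  unfolding hpro_objective_def level_average_def sum_distrib_left[of "1 / (real L - 1)"]
  by (intro sum.cong refl) (simp only: assms mse_at_time[where T = T] mult.assoc)

lemma opt_bu_objective_mse:
  "opt_bu_objective L N (mse H) T H x xhat =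
    level_average L N T H (\<lambda>l j t. (x l j t - at_time T (xhat l j) t)\<^sup>2)"
  unfolding opt_bu_objective_def level_average_def mse_at_time[where T = T]
  \<comment> \<open>The congruences lead down to a single time of the test period, where
    \<open>at_time_segment\<close> applies.\<close>
  by (intro arg_cong2[where f = "(*)"] sum.cong refl) (simp add: at_time_segment)

text \<open>Square a - c = (a - b) + (b - c) and apply the triangle inequality. In the theorem, a is
  the proxy forecast, b the true value and c the student forecast, so the last product is that of
  \<open>eps\<close> and \<open>delta\<close>.\<close>

lemma abs_diff_square_le:
  fixes a b c :: real
  shows "\<bar>(a - c)\<^sup>2 - (b - c)\<^sup>2\<bar> \<le> (a - b)\<^sup>2 + 2 * (\<bar>b - a\<bar> * \<bar>b - c\<bar>)"
proof -
  have "(a - c)\<^sup>2 - (b - c)\<^sup>2 = (a - b)\<^sup>2 + 2 * ((a - b) * (b - c))"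
    by (simp add: power2_eq_square algebra_simps)
  also have "\<bar>\<dots>\<bar> \<le> \<bar>(a - b)\<^sup>2\<bar> + \<bar>2 * ((a - b) * (b - c))\<bar>"
    by (rule abs_triangle_ineq)
  finally show ?thesis
    by (simp add: abs_mult abs_minus_commute)
qed

theorem theorem4p4:
  fixes L T H :: nat and N :: "nat \<Rightarrow> nat" and C :: "nat \<Rightarrow> nat \<Rightarrow> nat set"
    and x :: "nat \<Rightarrow> nat \<Rightarrow> nat \<Rightarrow> real"
    and \<Lambda> :: "'p set" and f :: "'p \<Rightarrow> (nat \<Rightarrow> real) \<Rightarrow> nat \<Rightarrow> real" and lam :: 'p
    and xtilde xhat :: "nat \<Rightarrow> nat \<Rightarrow> nat \<Rightarrow> real"
    and w :: "nat \<Rightarrow> real"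
    and eps delta :: "nat \<Rightarrow> nat \<Rightarrow> nat \<Rightarrow> real"
    and E Obj Obj_opt :: real
  assumes "hierarchical_dataset L N C T H x"
    and "L \<ge> 2"
    and "\<And>p. p \<in> \<Lambda> \<Longrightarrow> f p \<in> rvec T \<rightarrow> rvec H"
    and "lam \<in> \<Lambda>"
    and "\<And>l j. l \<in> {1..L - 1} \<Longrightarrow> j \<in> {1..N l} \<Longrightarrow> xtilde l j \<in> rvec H"
    and "\<And>l. l \<in> {1..L - 1} \<Longrightarrow> w l = 1 / (real L - 1)"
    and "\<And>l j. l \<in> {1..L - 1} \<Longrightarrow> j \<in> {1..N l}
      \<Longrightarrow> xhat l j = student_forecast L N C T H x (f lam) l j"
    and "\<And>l j t. l \<in> {1..L - 1} \<Longrightarrow> j \<in> {1..N l} \<Longrightarrow> t \<in> {T + 1..T + H}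
      \<Longrightarrow> eps l j t = \<bar>x l j t - at_time T (xtilde l j) t\<bar>"
    and "\<And>l j t. l \<in> {1..L - 1} \<Longrightarrow> j \<in> {1..N l} \<Longrightarrow> t \<in> {T + 1..T + H}
      \<Longrightarrow> delta l j t = \<bar>x l j t - at_time T (xhat l j) t\<bar>"
    and "E = 1 / (real L - 1) *
      (\<Sum>l = 1..L - 1. 1 / real (N l) * (\<Sum>j = 1..N l.
        1 / real H * (\<Sum>t = T + 1..T + H. (at_time T (xtilde l j) t - x l j t)\<^sup>2)))"
    and "Obj = hpro_objective L N (mse H) w xtilde xhat"
    and "Obj_opt = opt_bu_objective L N (mse H) T H x xhat"
  shows "\<bar>Obj - Obj_opt\<bar> \<le> E + 2 / (real L - 1) *
      (\<Sum>l = 1..L - 1. 1 / real (N l) * (\<Sum>j = 1..N l.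
        1 / real H * (\<Sum>t = T + 1..T + H. eps l j t * delta l j t)))"
proof -
  let ?A = "level_average L N T H"
  let ?u = "\<lambda>l j t. at_time T (xtilde l j) t" and ?v = "\<lambda>l j t. at_time T (xhat l j) t"
  have "\<bar>Obj - Obj_opt\<bar> = \<bar>?A (\<lambda>l j t. (?u l j t - ?v l j t)\<^sup>2 - (x l j t - ?v l j t)\<^sup>2)\<bar>"
    by (simp only: assms(11,12) hpro_objective_mse[OF assms(6), where T = T]
        opt_bu_objective_mse level_average_diff)
  also have "\<dots> \<le> ?A (\<lambda>l j t. \<bar>(?u l j t - ?v l j t)\<^sup>2 - (x l j t - ?v l j t)\<^sup>2\<bar>)"
    using \<open>L \<ge> 2\<close> by (intro abs_level_average_le) simp
  \<comment> \<open>The equations for \<open>eps\<close> and \<open>delta\<close> hold only on the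
    index range, which is where \<open>level_average_mono\<close> asks for the comparison.\<close>
  also have "\<dots> \<le> ?A (\<lambda>l j t. (?u l j t - x l j t)\<^sup>2 + 2 * (eps l j t * delta l j t))"
    using \<open>L \<ge> 2\<close> by (intro level_average_mono) (simp_all only: assms(8,9) abs_diff_square_le)
  \<comment> \<open>By linearity, the squared teacher errors average to \<open>E\<close>, and the
    cross terms keep their factor 2.\<close>
  also have "\<dots> = E + 2 * ?A (\<lambda>l j t. eps l j t * delta l j t)"
    by (simp only: level_average_add level_average_cmult assms(10) level_average_def[of L N T H])
  finally show ?thesis
    by (simp add: level_average_def)
qed

end
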